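(* Let $j$ be a nonnegative integer and let $k,\eta,a$ be three positive integers with $1\leq k<\eta=1+2+2^2+\cdots+2^j$ and $a=\eta-k$. For each $i=1,2,\ldots,a$, let $k+i=a_{i,0}\cdot 1+a_{i,1}\cdot 2+a_{i,2}\cdot 2^2+\cdots+a_{i,s_i}\cdot 2^{s_i}$ be the 2-adic representation of $k+i$, let $t_i$ be the positive integer determined by $2^{t_i-1}\leq i<2^{t_i}$, and put $b_i=\sum_{r=t_i}^{s_i}a_{i,r}2^{r}$. Then $ka=\sum_{i=1}^{a}b_i$.
   Context: The 2-adic representation of a positive integer $N$ is its binary expansion $N=a_0\cdot 1+a_1\cdot 2+a_2\cdot 2^2+\cdots+a_s\cdot 2^s$ with $a_s=1$ and $a_0,\ldots,a_{s-1}\in\{0,1\}$. A sum $\sum_{r=t}^{s}$ with $t>s$ is empty and equals $0$. *)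

theory Defs
  imports Main
begin

text \<open>
  \<open>binary_expansion N s c\<close>: the 2-adic representation of \<open>N\<close> is
  \<open>c 0 + c 1 * 2 + \<dots> + c s * 2 ^ s\<close>. Only the values \<open>c 0, \<dots>, c s\<close> matter;
  \<open>c s = 1\<close> forces \<open>N\<close> to be positive.
\<close>

definition binary_expansion :: "nat \<Rightarrow> nat \<Rightarrow> (nat \<Rightarrow> nat) \<Rightarrow> bool" where
  "binary_expansion N s c \<longleftrightarrow>
     c s = 1 \<and> (\<forall>r<s. c r \<in> {0, 1}) \<and> N = (\<Sum>r=0..s. c r * 2 ^ r)"

end

theory Submission
  imports Defs
begin

text \<open>
  Write \<open>w\<^sub>i = 2 ^ t\<^sub>i\<close> for the least power of two exceeding \<open>i\<close>. Replacing by zero the binary digits of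
  \<open>k + i\<close> below position \<open>t\<^sub>i\<close> leaves \<open>b\<^sub>i = w\<^sub>i * ((k + i) div w\<^sub>i)\<close>. Since \<open>k + a = 2 ^ J - 1\<close>
  with \<open>J = j + 1\<close>, the digits of \<open>k + i\<close> are complementary to those of \<open>a - i\<close>, so that
  \<open>b\<^sub>i + w\<^sub>i * ((a - i) div w\<^sub>i + 1) = 2 ^ J\<close>. Thus \<open>k\<close> drops out, and what has to be shown is
  \<open>(\<Sum>i=1..a. w\<^sub>i * ((a - i) div w\<^sub>i + 1)) = a * (a + 1)\<close>.

  The factor \<open>(a - i) div w\<^sub>i + 1\<close> counts the \<open>m\<close> in \<open>{i..a}\<close> with \<open>m \<equiv> i\<close> modulo \<open>w\<^sub>i\<close>. Exchanging
  the order of summation, the left side becomes the sum over \<open>m \<le> a\<close> of the weights \<open>w\<^sub>i\<close> of those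
  \<open>i\<close> in \<open>{1..m}\<close> with \<open>i \<equiv> m\<close> modulo \<open>w\<^sub>i\<close>. Such an \<open>i\<close> is exactly what remains of \<open>m\<close> when all
  binary digits above one chosen nonzero digit are erased; if that digit stands at position \<open>r\<close>, then
  \<open>w\<^sub>i = 2 * 2 ^ r\<close>. The weights therefore add up to \<open>2 * m\<close> (lemma \<open>sum_weights_truncations\<close>), and
  \<open>(\<Sum>m=1..a. 2 * m) = a * (a + 1)\<close>.
\<close>

definition binary_length :: "nat \<Rightarrow> nat" where
  "binary_length n = (LEAST t. n < 2 ^ t)"

lemma binary_length_le_iff: "binary_length n \<le> t \<longleftrightarrow> n < 2 ^ t"
proof
  have *: "n < 2 ^ binary_length n"
    unfolding binary_length_def by (rule LeastI[of _ n]) simp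
  assume "binary_length n \<le> t"
  then have "(2::nat) ^ binary_length n \<le> 2 ^ t" by simp
  with * show "n < 2 ^ t" by linarith
next
  assume "n < 2 ^ t"
  then show "binary_length n \<le> t" unfolding binary_length_def by (rule Least_le)
qed

lemma less_two_power_binary_length: "n < 2 ^ binary_length n"
  using binary_length_le_iff by blast

lemma binary_length_eqI:
  assumes "0 < t" and "2 ^ (t - 1) \<le> n" and "n < 2 ^ t"
  shows "binary_length n = t"
proof -
  have "binary_length n \<le> t" using assms(3) by (simp add: binary_length_le_iff)
  moreover have "\<not> binary_length n \<le> t - 1" using assms(2) by (simp add: binary_length_le_iff)
  ultimately show ?thesis using assms(1) by linarith
qed

text \<open>
  The nonzero terms belong to the truncations of \<open>n\<close> at its nonzero digits below position \<open>T\<close>. Passing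
  from \<open>T\<close> to \<open>Suc T\<close> admits the indices of binary length \<open>Suc T\<close>; among them only \<open>n mod 2 ^ Suc T\<close>
  can qualify, and it does so precisely when digit \<open>T\<close> of \<open>n\<close> is set.
\<close>

lemma sum_weights_truncations_below:
  "(\<Sum>i\<in>{1..<2 ^ T}. if i = n mod 2 ^ binary_length i then 2 ^ binary_length i else 0)
     = 2 * (n mod 2 ^ T)"
proof (induction T)
  case 0
  show ?case by simp
next
  case (Suc T)
  let ?f = "\<lambda>i. if i = n mod 2 ^ binary_length i then 2 ^ binary_length i else 0 :: nat"
  let ?r = "n mod 2 ^ Suc T"
  have split: "{1..<2 ^ Suc T} = {1..<2 ^ T} \<union> {2 ^ T..<2 ^ Suc T :: nat}"
    by (rule ivl_disj_un_two(3)[symmetric]) simp_all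
  have "sum ?f {2 ^ T..<2 ^ Suc T} = (\<Sum>i\<in>{2 ^ T..<2 ^ Suc T}. if i = ?r then 2 ^ Suc T else 0)"
  proof (rule sum.cong[OF refl])
    fix i :: nat
    assume "i \<in> {2 ^ T..<2 ^ Suc T}"
    then have "binary_length i = Suc T" by (intro binary_length_eqI) auto
    then show "?f i = (if i = ?r then 2 ^ Suc T else 0)" by (simp only:)
  qed
  also have "\<dots> = (if 2 ^ T \<le> ?r then 2 ^ Suc T else 0)" by simp
  finally have top: "sum ?f {2 ^ T..<2 ^ Suc T} = (if 2 ^ T \<le> ?r then 2 ^ Suc T else 0)" .
  have r: "?r = 2 ^ T * (n div 2 ^ T mod 2) + n mod 2 ^ T"
    by (metis mod_mult2_eq power_Suc2)
  have low: "n mod 2 ^ T < 2 ^ T" by simp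
  have "sum ?f {1..<2 ^ Suc T} = 2 * (n mod 2 ^ T) + (if 2 ^ T \<le> ?r then 2 ^ Suc T else 0)"
    unfolding split by (subst sum.union_disjoint) (use Suc.IH top in auto)
  also have "\<dots> = 2 * ?r"
  proof (cases "n div 2 ^ T mod 2 = 0")
    case True
    then have "?r = n mod 2 ^ T" using r by simp
    then show ?thesis using low by (simp only: linorder_not_le[symmetric] if_False)
  next
    case False
    then have "n div 2 ^ T mod 2 = 1" by simp
    then show ?thesis using r by simp
  qed
  finally show ?case .
qed

lemma sum_weights_truncations:
  "(\<Sum>i=1..n. if 2 ^ binary_length i dvd n - i then 2 ^ binary_length i else 0) = 2 * n"
proof -
  let ?f = "\<lambda>i. if i = n mod 2 ^ binary_length i then 2 ^ binary_length i else 0 :: nat"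
  let ?T = "binary_length n"
  have "(\<Sum>i=1..n. if 2 ^ binary_length i dvd n - i then 2 ^ binary_length i else 0) = sum ?f {1..n}"
  proof (rule sum.cong[OF refl])
    fix i
    assume "i \<in> {1..n}"
    then have "2 ^ binary_length i dvd n - i \<longleftrightarrow> n mod 2 ^ binary_length i = i mod 2 ^ binary_length i"
      by (simp add: mod_eq_dvd_iff_nat)
    also have "\<dots> \<longleftrightarrow> i = n mod 2 ^ binary_length i"
      using less_two_power_binary_length[of i] by auto
    finally show "(if 2 ^ binary_length i dvd n - i then 2 ^ binary_length i else 0) = ?f i" by simp
  qed
  also have "\<dots> = sum ?f {1..<2 ^ ?T}"
  proof (rule sum.mono_neutral_left)
    show "{1..n} \<subseteq> {1..<2 ^ ?T}" using less_two_power_binary_length[of n] by auto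
    \<comment> \<open>Erasing digits of \<open>n\<close> never yields a number above \<open>n\<close>.\<close>
    show "\<forall>i\<in>{1..<2 ^ ?T} - {1..n}. ?f i = 0"
    proof
      fix i
      assume "i \<in> {1..<2 ^ ?T} - {1..n}"
      then have "n < i" by auto
      moreover have "n mod 2 ^ binary_length i \<le> n" by (rule mod_less_eq_dividend)
      ultimately have "i \<noteq> n mod 2 ^ binary_length i" by linarith
      then show "?f i = 0" by (simp only: if_False)
    qed
  qed simp
  also have "\<dots> = 2 * n"
    using sum_weights_truncations_below[of n ?T] less_two_power_binary_length[of n] by simp
  finally show ?thesis .
qed

text \<open>
  This is the exchange of summations, carried out as an induction: raising \<open>a\<close> to \<open>Suc a\<close> increases
  the quotient \<open>(a - i) div w\<^sub>i\<close> by one exactly for the \<open>i\<close> with \<open>Suc a \<equiv> i\<close> modulo \<open>w\<^sub>i\<close>.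
\<close>

lemma sum_weighted_quotients:
  "(\<Sum>i=1..a. 2 ^ binary_length i * ((a - i) div 2 ^ binary_length i + 1)) = a * (a + 1)"
proof (induction a)
  case 0
  show ?case by simp
next
  case (Suc a)
  let ?w = "\<lambda>i. 2 ^ binary_length i :: nat"
  let ?d = "\<lambda>i. if ?w i dvd Suc a - i then ?w i else 0"
  have step: "?w i * ((Suc a - i) div ?w i + 1) = ?w i * ((a - i) div ?w i + 1) + ?d i"
    if "i \<in> {1..a}" for i
  proof -
    have "Suc a - i = Suc (a - i)" using that by auto
    then show ?thesis by (simp add: div_Suc dvd_eq_mod_eq_0)
  qed
  have "(\<Sum>i=1..Suc a. ?w i * ((Suc a - i) div ?w i + 1))
      = (\<Sum>i=1..a. ?w i * ((Suc a - i) div ?w i + 1)) + ?d (Suc a)"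
    by simp
  also have "(\<Sum>i=1..a. ?w i * ((Suc a - i) div ?w i + 1))
      = (\<Sum>i=1..a. ?w i * ((a - i) div ?w i + 1)) + sum ?d {1..a}"
    unfolding sum.distrib[symmetric] by (rule sum.cong[OF refl step])
  also have "\<dots> + ?d (Suc a) = a * (a + 1) + sum ?d {1..Suc a}"
    using Suc.IH by simp
  also have "\<dots> = Suc a * (Suc a + 1)"
    by (subst sum_weights_truncations) simp
  finally show ?case .
qed

lemma sum_binary_digits_less:
  fixes c :: "nat \<Rightarrow> nat"
  assumes "\<And>r. r < n \<Longrightarrow> c r \<le> 1"
  shows "(\<Sum>r<n. c r * 2 ^ r) < 2 ^ n"
  using assms
proof (induction n)
  case 0
  show ?case by simp
next
  case (Suc n)
  have "(\<Sum>r<n. c r * 2 ^ r) < 2 ^ n" using Suc by simp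
  moreover have "c n * 2 ^ n \<le> 2 ^ n" using Suc.prems[of n] by simp
  ultimately show ?case by (simp only: sum.lessThan_Suc power_Suc)
qed

lemma sum_high_binary_digits:
  assumes "binary_expansion N s c"
  shows "(\<Sum>r=t..s. c r * 2 ^ r) = 2 ^ t * (N div 2 ^ t)"
proof -
  \<comment> \<open>Padding with zeros above position \<open>s\<close> makes the case \<open>t > s\<close> uniform with the other.\<close>
  define d where "d r = (if r \<le> s then c r else 0)" for r
  have d_le: "d r \<le> 1" for r
    using assms unfolding binary_expansion_def d_def by (cases r s rule: linorder_cases) auto
  have "N = (\<Sum>r=0..s. c r * 2 ^ r)" using assms by (simp add: binary_expansion_def)
  also have "\<dots> = (\<Sum>r\<in>{..<t} \<union> {t..s}. d r * 2 ^ r)"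
    by (rule sum.mono_neutral_cong_left) (auto simp: d_def)
  also have "\<dots> = (\<Sum>r<t. d r * 2 ^ r) + (\<Sum>r=t..s. d r * 2 ^ r)"
    by (rule sum.union_disjoint) auto
  also have "(\<Sum>r=t..s. d r * 2 ^ r) = (\<Sum>r=t..s. c r * 2 ^ r)"
    by (simp add: d_def)
  finally have N: "N = (\<Sum>r<t. d r * 2 ^ r) + (\<Sum>r=t..s. c r * 2 ^ r)" .
  have "2 ^ t dvd (\<Sum>r=t..s. c r * 2 ^ r)"
    by (intro dvd_sum dvd_mult le_imp_power_dvd) simp
  then obtain q where q: "(\<Sum>r=t..s. c r * 2 ^ r) = 2 ^ t * q" by (elim dvdE)
  have "N div 2 ^ t = q"
    using sum_binary_digits_less[of t d] d_le N q by simp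
  with q show ?thesis by simp
qed

text \<open>
  As \<open>x + y + 1\<close> is a multiple of \<open>w\<close>, the remainders of \<open>x\<close> and \<open>y\<close> modulo \<open>w\<close> must add up to
  \<open>w - 1\<close>: for a power of two, their low digits are complementary.
\<close>

lemma complementary_quotients:
  fixes x y w :: nat
  assumes "w dvd x + y + 1" and "0 < w"
  shows "w * (x div w) + w * (y div w + 1) = x + y + 1"
proof -
  have x: "w * (x div w) + x mod w = x" and y: "w * (y div w) + y mod w = y" by simp_all
  have eq: "x + y + 1 = w * (x div w + y div w) + (x mod w + y mod w + 1)"
    using x y by (simp add: algebra_simps)
  with assms(1) have "w dvd x mod w + y mod w + 1"
    by (metis dvd_add_right_iff dvd_triv_left)
  then obtain q where q: "x mod w + y mod w + 1 = w * q" by (elim dvdE)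
  have "x mod w < w" and "y mod w < w" using assms(2) by simp_all
  then have "0 < w * q" and "w * q < w * 2" using q by linarith+
  then have "q = 1" by auto
  with q eq show ?thesis by (simp add: algebra_simps)
qed

theorem theorem1p4:
  fixes j k \<eta> a :: nat
    and c :: "nat \<Rightarrow> nat \<Rightarrow> nat"
    and s t b :: "nat \<Rightarrow> nat"
  assumes "0 < k" and "0 < \<eta>" and "0 < a"
    and "1 \<le> k" and "k < \<eta>"
    and "\<eta> = (\<Sum>r=0..j. 2 ^ r)"
    and "a = \<eta> - k"
    and "\<And>i. i \<in> {1..a} \<Longrightarrow> binary_expansion (k + i) (s i) (c i)"
    and "\<And>i. i \<in> {1..a} \<Longrightarrow> 0 < t i \<and> 2 ^ (t i - 1) \<le> i \<and> i < 2 ^ t i"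
    and "\<And>i. i \<in> {1..a} \<Longrightarrow> b i = (\<Sum>r=t i..s i. c i r * 2 ^ r)"
  shows "k * a = (\<Sum>i=1..a. b i)"
proof -
  let ?w = "\<lambda>i. 2 ^ binary_length i :: nat"
  have "\<eta> + 1 = 2 ^ Suc j"
    unfolding assms(6) by (induction j) simp_all
  then have J: "k + a + 1 = 2 ^ Suc j" using assms(5,7) by simp
  have complement: "b i + ?w i * ((a - i) div ?w i + 1) = k + a + 1" if i: "i \<in> {1..a}" for i
  proof -
    have "binary_length i = t i" using assms(9)[OF i] by (intro binary_length_eqI) auto
    then have b: "b i = ?w i * ((k + i) div ?w i)"
      using assms(10)[OF i] sum_high_binary_digits[OF assms(8)[OF i]] by simp
    have "i < 2 ^ Suc j" using i J by simp
    then have "?w i dvd 2 ^ Suc j"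
      by (intro le_imp_power_dvd) (simp only: binary_length_le_iff)
    moreover have "(k + i) + (a - i) + 1 = 2 ^ Suc j" using i J by simp
    ultimately show ?thesis
      unfolding b using complementary_quotients[of "?w i" "k + i" "a - i"] J by simp
  qed
  have "(\<Sum>i=1..a. b i) + a * (a + 1) = (\<Sum>i=1..a. b i + ?w i * ((a - i) div ?w i + 1))"
    unfolding sum.distrib sum_weighted_quotients ..
  also have "\<dots> = a * (k + a + 1)" by (subst sum.cong[OF refl complement]) simp_all
  finally show ?thesis by (simp add: algebra_simps)
qed

end
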